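(* Let $r_1,r_2,\rho_1,\rho_2$ be real numbers with $r_1+r_2-\rho_1-\rho_2\notin\{1,2,3,\dots\}$, and let $P_n$ ($n\ge0$) be the monic polynomial eigenfunctions of the Dunkl shift operator $L$ defined in the context. Put $g=\rho_1+\rho_2-r_1-r_2$. Then the polynomials $P_n$ satisfy $$P_{n+1}(x)+(\rho_1-A_n-C_n)P_n(x)+A_{n-1}C_nP_{n-1}(x)=xP_n(x),\qquad n\ge0,$$ where $P_{-1}=0$, $C_0=0$, and $$A_n=\begin{cases}\dfrac{(n+1+2\rho_1-2r_1)(n+1+2\rho_1-2r_2)}{4(n+1+g)}, & n\text{ even},\\[8pt] \dfrac{(n+1+2g)(n+1+2\rho_1+2\rho_2)}{4(n+1+g)}, & n \text{ odd},\end{cases}$$ $$C_n=\begin{cases}-\dfrac{n(n-2r_1-2r_2)}{4(n+g)}, & n\text{ even},\ n\ge 2,\\[8pt] -\dfrac{(n-2r_2+2\rho_2)(n-2r_1+2\rho_2)}{4(n+g)}, & n \text{ odd}.\end{cases}$$ Consequently $P_n$ coincides with the monic Bannai-Ito polynomial with parameters $$\theta_0=\rho_1,\ h=\tfrac14,\ \tau_1=2(\rho_1-r_1),\ \tau_2=2(\rho_1-r_2),\ \tau_3=-2(\rho_1+\rho_2),\ s^*=2(r_1+r_2-\rho_1-\rho_2).$$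
   Context: For real parameters $r_1,r_2,\rho_1,\rho_2$ the Dunkl shift operator $L$ acts on polynomials by $$Lf(x)=F(x)(f(x)-f(-x))+G(x)(f(-x-1)-f(x)),\quad F(x)=\frac{(x-\rho_1)(x-\rho_2)}{2x},\quad G(x)=\frac{(x-r_1+1/2)(x-r_2+1/2)}{2x+1}.$$ It maps polynomials to polynomials and $Lx^n=\lambda_nx^n+O(x^{n-1})$ with $\lambda_n=n/2$ for even $n$ and $\lambda_n=r_1+r_2-\rho_1-\rho_2-(n+1)/2$ for odd $n$. If $r_1+r_2-\rho_1-\rho_2\notin\{1,2,\dots\}$, the $\lambda_n$ are pairwise distinct, and $P_n$ denotes the unique monic polynomial of degree $n$ with $LP_n=\lambda_nP_n$. The monic Bannai-Ito polynomials with parameters $\theta_0,h,\tau_1,\tau_2,\tau_3,s^*$ are defined by $P_{-1}=0$, $P_0=1$ and $P_{n+1}(x)+b_nP_n(x)+u_nP_{n-1}(x)=xP_n(x)$, where $u_n=A_{n-1}C_n$, $b_n=\theta_0-A_n-C_n$, and $$A_n=\begin{cases}\frac{2h(n+1+\tau_1)(n+1+\tau_2)}{2n+2-s^*}, & n\text{ even},\\ \frac{2h(n+1-s^* )(n+1-\tau_3)}{2n+2-s^*}, & n\text{ odd},\end{cases}\qquad C_n=\begin{cases}-\frac{2hn(n-s^*+\tau_3)}{2n-s^*}, & n\text{ even},\\ -\frac{2h(n-\tau_1-s^* )(n-\tau_2-s^* )}{2n-s^*}, & n\text{ odd},\end{cases}$$ with $C_0=0$. *)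

theory Defs
  imports Complex_Main "HOL-Computational_Algebra.Polynomial"
begin

definition dunkl_F :: "real \<Rightarrow> real \<Rightarrow> real \<Rightarrow> real" where
  "dunkl_F \<rho>1 \<rho>2 x = (x - \<rho>1) * (x - \<rho>2) / (2 * x)"

definition dunkl_G :: "real \<Rightarrow> real \<Rightarrow> real \<Rightarrow> real" where
  "dunkl_G r1 r2 x = (x - r1 + 1/2) * (x - r2 + 1/2) / (2 * x + 1)"

(* Meaningful for x different from 0 and -1/2 only: at these two points the formula
   divides by zero, which HOL evaluates to 0. *)
definition dunkl_shift ::
    "real \<Rightarrow> real \<Rightarrow> real \<Rightarrow> real \<Rightarrow> (real \<Rightarrow> real) \<Rightarrow> real \<Rightarrow> real" where
  "dunkl_shift r1 r2 \<rho>1 \<rho>2 f x =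
     dunkl_F \<rho>1 \<rho>2 x * (f x - f (- x)) + dunkl_G r1 r2 x * (f (- x - 1) - f x)"

(* The action of L on polynomials; the two removable singularities are excluded. *)
definition dunkl_shift_poly ::
    "real \<Rightarrow> real \<Rightarrow> real \<Rightarrow> real \<Rightarrow> real poly \<Rightarrow> real poly" where
  "dunkl_shift_poly r1 r2 \<rho>1 \<rho>2 p =
     (THE q. \<forall>x. x \<noteq> 0 \<longrightarrow> x \<noteq> - 1/2 \<longrightarrow>
        poly q x = dunkl_shift r1 r2 \<rho>1 \<rho>2 (poly p) x)"

lemma poly_eqI_off_finite:
  fixes p q :: "real poly"
  assumes "finite S" "\<And>x. x \<notin> S \<Longrightarrow> poly p x = poly q x"
  shows "p = q"
proof (rule ccontr)
  assume "p \<noteq> q"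
  then have "finite {x. poly (p - q) x = 0}"
    by (intro poly_roots_finite) simp
  moreover have "- S \<subseteq> {x. poly (p - q) x = 0}"
    using assms(2) by auto
  ultimately have "finite (- S)"
    using finite_subset by blast
  then have "finite (UNIV :: real set)"
    using assms(1) by (metis Compl_partition finite_UnI)
  then show False
    using infinite_UNIV_char_0 by blast
qed

lemma dunkl_shift_poly_exists:
  "\<exists>q. \<forall>x. x \<noteq> 0 \<longrightarrow> x \<noteq> - 1/2 \<longrightarrow>
     poly q x = dunkl_shift r1 r2 \<rho>1 \<rho>2 (poly p) x"
proof -
  have "poly (p - pcompose p [:0, -1:]) 0 = 0"
    by (simp add: poly_pcompose)
  then obtain a where a: "p - pcompose p [:0, -1:] = [:- 0, 1:] * a"
    unfolding poly_eq_0_iff_dvd by (auto elim: dvdE)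
  have "poly (pcompose p [:-1, -1:] - p) (- 1/2) = 0"
    by (simp add: poly_pcompose)
  then obtain b where b: "pcompose p [:-1, -1:] - p = [:- (- 1/2), 1:] * b"
    unfolding poly_eq_0_iff_dvd by (auto elim: dvdE)
  define q where
    "q = smult (1/2) ([:- \<rho>1, 1:] * [:- \<rho>2, 1:] * a + [:1/2 - r1, 1:] * [:1/2 - r2, 1:] * b)"
  have "poly q x = dunkl_shift r1 r2 \<rho>1 \<rho>2 (poly p) x" if "x \<noteq> 0" "x \<noteq> - 1/2" for x
  proof -
    have 1: "poly p x - poly p (- x) = x * poly a x"
      using arg_cong[OF a, of "\<lambda>p. poly p x"] by (simp add: poly_pcompose)
    have 2: "poly p (- x - 1) - poly p x = (x + 1/2) * poly b x"
    proof -
      have "- 1 - x = - x - 1"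
        by simp
      with arg_cong[OF b, of "\<lambda>p. poly p x"] show ?thesis
        by (simp add: poly_pcompose add.commute distrib_right del: minus_diff_commute)
    qed
    have nz: "2 * x + 1 \<noteq> 0"
      using that by auto
    have "dunkl_F \<rho>1 \<rho>2 x * (x * poly a x) = (x - \<rho>1) * (x - \<rho>2) * poly a x / 2"
      using that by (simp add: dunkl_F_def)
    moreover have "dunkl_G r1 r2 x * ((x + 1/2) * poly b x)
        = (x - r1 + 1/2) * (x - r2 + 1/2) * poly b x / 2"
      using nz by (simp add: dunkl_G_def divide_simps)
    ultimately show ?thesis
      unfolding dunkl_shift_def 1 2 by (simp add: q_def algebra_simps)
  qed
  then show ?thesis
    by blast
qed

lemma poly_dunkl_shift_poly:
  assumes "x \<noteq> 0" "x \<noteq> - 1/2"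
  shows "poly (dunkl_shift_poly r1 r2 \<rho>1 \<rho>2 p) x = dunkl_shift r1 r2 \<rho>1 \<rho>2 (poly p) x"
proof -
  have "\<exists>!q. \<forall>x. x \<noteq> 0 \<longrightarrow> x \<noteq> - 1/2 \<longrightarrow>
      poly q x = dunkl_shift r1 r2 \<rho>1 \<rho>2 (poly p) x"
  proof (rule ex_ex1I[OF dunkl_shift_poly_exists])
    fix q q' assume
      "\<forall>x. x \<noteq> 0 \<longrightarrow> x \<noteq> - 1/2 \<longrightarrow> poly q x = dunkl_shift r1 r2 \<rho>1 \<rho>2 (poly p) x"
      "\<forall>x. x \<noteq> 0 \<longrightarrow> x \<noteq> - 1/2 \<longrightarrow> poly q' x = dunkl_shift r1 r2 \<rho>1 \<rho>2 (poly p) x"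
    then show "q = q'"
      by (intro poly_eqI_off_finite[of "{0, - 1/2}"]) auto
  qed
  from theI'[OF this] show ?thesis
    using assms unfolding dunkl_shift_poly_def by blast
qed

definition dunkl_eigenvalue :: "real \<Rightarrow> real \<Rightarrow> real \<Rightarrow> real \<Rightarrow> nat \<Rightarrow> real" where
  "dunkl_eigenvalue r1 r2 \<rho>1 \<rho>2 n =
     (if even n then real n / 2 else r1 + r2 - \<rho>1 - \<rho>2 - (real n + 1) / 2)"

definition dunkl_eigenpoly :: "real \<Rightarrow> real \<Rightarrow> real \<Rightarrow> real \<Rightarrow> nat \<Rightarrow> real poly" where
  "dunkl_eigenpoly r1 r2 \<rho>1 \<rho>2 n =
     (THE p. degree p = n \<and> lead_coeff p = 1 \<and>
        dunkl_shift_poly r1 r2 \<rho>1 \<rho>2 p = smult (dunkl_eigenvalue r1 r2 \<rho>1 \<rho>2 n) p)"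

definition BI_A :: "real \<Rightarrow> real \<Rightarrow> real \<Rightarrow> real \<Rightarrow> real \<Rightarrow> nat \<Rightarrow> real" where
  "BI_A h \<tau>1 \<tau>2 \<tau>3 s n =
     (if even n then 2 * h * (real n + 1 + \<tau>1) * (real n + 1 + \<tau>2) / (2 * real n + 2 - s)
      else 2 * h * (real n + 1 - s) * (real n + 1 - \<tau>3) / (2 * real n + 2 - s))"

definition BI_C :: "real \<Rightarrow> real \<Rightarrow> real \<Rightarrow> real \<Rightarrow> real \<Rightarrow> nat \<Rightarrow> real" where
  "BI_C h \<tau>1 \<tau>2 \<tau>3 s n =
     (if n = 0 then 0
      else if even n then - (2 * h * real n * (real n - s + \<tau>3) / (2 * real n - s))
      else - (2 * h * (real n - \<tau>1 - s) * (real n - \<tau>2 - s) / (2 * real n - s)))"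

definition BI_b :: "real \<Rightarrow> real \<Rightarrow> real \<Rightarrow> real \<Rightarrow> real \<Rightarrow> real \<Rightarrow> nat \<Rightarrow> real" where
  "BI_b \<theta>0 h \<tau>1 \<tau>2 \<tau>3 s n = \<theta>0 - BI_A h \<tau>1 \<tau>2 \<tau>3 s n - BI_C h \<tau>1 \<tau>2 \<tau>3 s n"

(* Used for n > 0 only; the term with u_0 in the recurrence is multiplied by P_{-1} = 0. *)
definition BI_u :: "real \<Rightarrow> real \<Rightarrow> real \<Rightarrow> real \<Rightarrow> real \<Rightarrow> nat \<Rightarrow> real" where
  "BI_u h \<tau>1 \<tau>2 \<tau>3 s n = BI_A h \<tau>1 \<tau>2 \<tau>3 s (n - 1) * BI_C h \<tau>1 \<tau>2 \<tau>3 s n"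

fun bannai_ito :: "real \<Rightarrow> real \<Rightarrow> real \<Rightarrow> real \<Rightarrow> real \<Rightarrow> real \<Rightarrow> nat \<Rightarrow> real poly" where
  "bannai_ito \<theta>0 h \<tau>1 \<tau>2 \<tau>3 s 0 = 1"
| "bannai_ito \<theta>0 h \<tau>1 \<tau>2 \<tau>3 s (Suc 0) = [:0, 1:] - [:BI_b \<theta>0 h \<tau>1 \<tau>2 \<tau>3 s 0:]"
| "bannai_ito \<theta>0 h \<tau>1 \<tau>2 \<tau>3 s (Suc (Suc n)) =
     [:0, 1:] * bannai_ito \<theta>0 h \<tau>1 \<tau>2 \<tau>3 s (Suc n)
     - smult (BI_b \<theta>0 h \<tau>1 \<tau>2 \<tau>3 s (Suc n)) (bannai_ito \<theta>0 h \<tau>1 \<tau>2 \<tau>3 s (Suc n))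
     - smult (BI_u h \<tau>1 \<tau>2 \<tau>3 s (Suc n)) (bannai_ito \<theta>0 h \<tau>1 \<tau>2 \<tau>3 s n)"

definition dunkl_g :: "real \<Rightarrow> real \<Rightarrow> real \<Rightarrow> real \<Rightarrow> real" where
  "dunkl_g r1 r2 \<rho>1 \<rho>2 = \<rho>1 + \<rho>2 - r1 - r2"

definition dunkl_A :: "real \<Rightarrow> real \<Rightarrow> real \<Rightarrow> real \<Rightarrow> nat \<Rightarrow> real" where
  "dunkl_A r1 r2 \<rho>1 \<rho>2 n = (let g = dunkl_g r1 r2 \<rho>1 \<rho>2 in
     if even n
     then (real n + 1 + 2 * \<rho>1 - 2 * r1) * (real n + 1 + 2 * \<rho>1 - 2 * r2) / (4 * (real n + 1 + g))
     else (real n + 1 + 2 * g) * (real n + 1 + 2 * \<rho>1 + 2 * \<rho>2) / (4 * (real n + 1 + g)))"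

definition dunkl_C :: "real \<Rightarrow> real \<Rightarrow> real \<Rightarrow> real \<Rightarrow> nat \<Rightarrow> real" where
  "dunkl_C r1 r2 \<rho>1 \<rho>2 n = (let g = dunkl_g r1 r2 \<rho>1 \<rho>2 in
     if n = 0 then 0
     else if even n then - (real n * (real n - 2 * r1 - 2 * r2) / (4 * (real n + g)))
     else - ((real n - 2 * r2 + 2 * \<rho>2) * (real n - 2 * r1 + 2 * \<rho>2) / (4 * (real n + g))))"

end

theory Submission
  imports Defs
begin

text \<open>Split the operator into two parts, \<open>L = H + K\<close>, with
  \<open>H f(x) = F(x) (f(x) - f(-x))\<close> and \<open>K f(x) = G(x) (f(-x-1) - f(x))\<close>. Each part is built on one
  reflection of the line, so each satisfies a quadratic equation,
  \<open>H\<^sup>2 = - (\<rho>1 + \<rho>2) H\<close> and \<open>K\<^sup>2 = (r1 + r2) K\<close>; and with \<open>X\<close> the multiplication by the variable,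
  \<open>M = X + K\<close> satisfies a quadratic equation as well (\<open>K_K\<close>, \<open>H_H\<close>, \<open>M_M\<close>).

  The equations for \<open>H\<close> and \<open>K\<close>, together with the fact that \<open>L X + X L + K\<close> is the multiplication
  by a linear polynomial, imply that the anticommutators of \<open>L\<close> with \<open>K\<close> and with \<open>M\<close> are
  combinations of \<open>L\<^sup>2\<close>, \<open>L\<close>, \<open>1\<close> and \<open>K\<close>, respectively \<open>M\<close> (\<open>L_K_anticommutator\<close>,
  \<open>L_M_anticommutator\<close>). Hence, if \<open>L p = \<mu> p\<close>, the span of \<open>p\<close> and \<open>K p\<close> is \<open>L\<close>-invariant with
  second eigenvalue \<open>- g - \<mu>\<close>, and the span of \<open>p\<close> and \<open>M p\<close> is \<open>L\<close>-invariant with second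
  eigenvalue \<open>- g - 1 - \<mu>\<close>. For \<open>\<mu> = \<lambda>\<^sub>n\<close> the former is \<open>\<lambda>\<^sub>n\<^sub>+\<^sub>1\<close> if \<open>n\<close> is odd, the latter is
  \<open>\<lambda>\<^sub>n\<^sub>+\<^sub>1\<close> if \<open>n\<close> is even. So, starting from the constant \<open>1\<close>, alternate applications of
  \<open>M + const\<close> and \<open>const - K\<close> produce polynomials \<open>Q n\<close> with \<open>L (Q n) = \<lambda>\<^sub>n Q n\<close> (\<open>L_Q\<close>).

  The three-term recurrence follows from the same quadratic equations. For odd \<open>n\<close>, the
  plane spanned by \<open>Q n\<close> and \<open>Q (n+1)\<close> is \<open>K\<close>-invariant, so that \<open>K (Q (n+1))\<close> is a combination of
  \<open>Q n\<close> and \<open>Q (n+1)\<close>; on the other hand \<open>K (Q (n+1)) = Q (n+2) - X Q (n+1) + const Q (n+1)\<close> by the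
  definition of \<open>Q (n+2)\<close>. Comparing the two gives the recurrence. For even \<open>n\<close> the roles of \<open>K\<close>
  and \<open>M\<close> are exchanged (\<open>Q_rec\<close>).

  From the recurrence \<open>Q n\<close> is monic of degree \<open>n\<close>. The \<open>Q n\<close> are thus a basis
  in which \<open>L\<close> is diagonal, with distinct eigenvalues, so \<open>Q n\<close> is the only monic eigenpolynomial
  of degree \<open>n\<close> (\<open>dunkl_eigenpoly_eq_Q\<close>).\<close>

section \<open>The operator and its two parts\<close>

locale dunkl_parameters =
  fixes r1 r2 \<rho>1 \<rho>2 :: real
begin

abbreviation "g \<equiv> dunkl_g r1 r2 \<rho>1 \<rho>2"
abbreviation "F \<equiv> dunkl_F \<rho>1 \<rho>2"
abbreviation "G \<equiv> dunkl_G r1 r2"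
abbreviation "L \<equiv> dunkl_shift_poly r1 r2 \<rho>1 \<rho>2"
abbreviation "ev \<equiv> dunkl_eigenvalue r1 r2 \<rho>1 \<rho>2"
abbreviation "A \<equiv> dunkl_A r1 r2 \<rho>1 \<rho>2"
abbreviation "C \<equiv> dunkl_C r1 r2 \<rho>1 \<rho>2"
abbreviation "X \<equiv> [:0, 1:] :: real poly"
abbreviation "\<beta> \<equiv> \<rho>1 * \<rho>2 - (r1 - 1/2) * (r2 - 1/2)"

text \<open>This expression is visibly a polynomial; \<open>poly_K\<close> identifies it with the second summand
  \<open>G x * (poly p (- x - 1) - poly p x)\<close> of \<open>L\<close>. The linear polynomial arises as the difference of
  \<open>(x - \<rho>1) (x - \<rho>2)\<close> and \<open>(x - r1 + 1/2) (x - r2 + 1/2)\<close>.\<close>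

definition K :: "real poly \<Rightarrow> real poly" where
  "K p = [:\<beta>, - (g + 1):] * p - L (X * p) - X * L p"

definition H :: "real poly \<Rightarrow> real poly" where
  "H p = L p - K p"

lemma poly_L:
  assumes "x \<noteq> 0" "x \<noteq> - 1/2"
  shows "poly (L p) x = F x * (poly p x - poly p (- x)) + G x * (poly p (- x - 1) - poly p x)"
  using poly_dunkl_shift_poly[OF assms] by (simp add: dunkl_shift_def)

lemma L_add: "L (p + q) = L p + L q"
  by (rule poly_eqI_off_finite[of "{0, - 1/2}"]) (simp_all add: poly_L algebra_simps)

lemma L_smult: "L (smult c p) = smult c (L p)"
  by (rule poly_eqI_off_finite[of "{0, - 1/2}"]) (simp_all add: poly_L algebra_simps)

lemma L_1: "L 1 = 0"
  by (rule poly_eqI_off_finite[of "{0, - 1/2}"]) (simp_all add: poly_L)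

lemma L_diff: "L (p - q) = L p - L q"
  using L_add[of p "smult (- 1) q"] L_smult[of "- 1" q] by simp

section \<open>Quadratic relations and anticommutators\<close>

lemma F_times: "x \<noteq> 0 \<Longrightarrow> 2 * x * F x = (x - \<rho>1) * (x - \<rho>2)"
  by (simp add: dunkl_F_def)

lemma G_times: "x \<noteq> - 1/2 \<Longrightarrow> (2 * x + 1) * G x = (x - r1 + 1/2) * (x - r2 + 1/2)"
  by (simp add: dunkl_G_def)

lemma F_reflect: "x \<noteq> 0 \<Longrightarrow> F x + F (- x) = - (\<rho>1 + \<rho>2)"
  by (simp add: dunkl_F_def field_simps)

lemma G_reflect:
  assumes "x \<noteq> - 1/2"
  shows "G x + G (- x - 1) = - (r1 + r2)"
proof -
  have nz: "2 * x + 1 \<noteq> 0" using assms by auto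
  have "2 * (- x - 1) + 1 = - (2 * x + 1)" by simp
  then have "G (- x - 1) = - ((- x - 1 - r1 + 1/2) * (- x - 1 - r2 + 1/2) / (2 * x + 1))"
    unfolding dunkl_G_def by (metis divide_minus_right)
  then have "G x + G (- x - 1) =
      ((x - r1 + 1/2) * (x - r2 + 1/2) - (- x - 1 - r1 + 1/2) * (- x - 1 - r2 + 1/2)) / (2 * x + 1)"
    unfolding dunkl_G_def by (simp add: diff_divide_distrib)
  also have "\<dots> = (- (r1 + r2) * (2 * x + 1)) / (2 * x + 1)"
    by (rule arg_cong[where f = "\<lambda>y. y / (2 * x + 1)"]) (simp add: algebra_simps)
  finally show ?thesis using nz by simp
qed

lemma poly_K:
  assumes "x \<noteq> 0" "x \<noteq> - 1/2"
  shows "poly (K p) x = G x * (poly p (- x - 1) - poly p x)"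
proof -
  have "poly (K p) x = G x * (poly p (- x - 1) - poly p x)
      + (\<beta> - (g + 1) * x - 2 * x * F x + (2 * x + 1) * G x) * poly p x"
    using assms by (simp add: K_def poly_L algebra_simps)
  moreover have "\<beta> - (g + 1) * x - 2 * x * F x + (2 * x + 1) * G x = 0"
    unfolding F_times[OF assms(1)] G_times[OF assms(2)]
    by (simp add: dunkl_g_def algebra_simps)
  ultimately show ?thesis by simp
qed

lemma poly_H:
  assumes "x \<noteq> 0" "x \<noteq> - 1/2"
  shows "poly (H p) x = F x * (poly p x - poly p (- x))"
  using assms by (simp add: H_def poly_L poly_K)

lemma K_add: "K (p + q) = K p + K q"
  by (rule poly_eqI_off_finite[of "{0, - 1/2}"]) (simp_all add: poly_K algebra_simps)

lemma K_smult: "K (smult c p) = smult c (K p)"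
  by (rule poly_eqI_off_finite[of "{0, - 1/2}"]) (simp_all add: poly_K algebra_simps)

lemma K_diff: "K (p - q) = K p - K q"
  using K_add[of p "smult (- 1) q"] K_smult[of "- 1" q] by simp

lemma K_1: "K 1 = 0"
  by (rule poly_eqI_off_finite[of "{0, - 1/2}"]) (simp_all add: poly_K)

text \<open>The reflection \<open>x \<mapsto> - x - 1\<close> is an involution and turns \<open>K p\<close> into
  \<open>- (G (- x - 1) / G x)\<close> times itself. The quadratic relation is therefore a statement about the
  function \<open>G x + G (- x - 1)\<close>, which is constant.\<close>

lemma K_K: "K (K p) = smult (r1 + r2) (K p)"
proof (rule poly_eqI_off_finite[of "{0, - 1/2, - 1}"])
  fix x :: real
  assume x: "x \<notin> {0, - 1/2, - 1}"
  then have "- x - 1 \<noteq> 0" "- x - 1 \<noteq> - 1/2" by auto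
  then have "poly (K p) (- x - 1) = G (- x - 1) * (poly p x - poly p (- x - 1))"
    by (simp add: poly_K)
  moreover have expand: "a * (b * (u - v) - a * (v - u)) = - (a + b) * (a * (v - u))"
    for a b u v :: real
    by algebra
  ultimately have "poly (K (K p)) x =
      - (G x + G (- x - 1)) * (G x * (poly p (- x - 1) - poly p x))"
    using x by (simp only: poly_K insert_iff empty_iff de_Morgan_disj simp_thms expand)
  also have "\<dots> = (r1 + r2) * (G x * (poly p (- x - 1) - poly p x))"
    using x by (subst G_reflect) simp_all
  finally show "poly (K (K p)) x = poly (smult (r1 + r2) (K p)) x"
    using x by (simp add: poly_K)
qed simp

lemma H_H: "H (H p) = - smult (\<rho>1 + \<rho>2) (H p)"
proof (rule poly_eqI_off_finite[of "{0, - 1/2, 1/2}"])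
  fix x :: real
  assume x: "x \<notin> {0, - 1/2, 1/2}"
  then have "- x \<noteq> 0" "- x \<noteq> - 1/2" by auto
  then have "poly (H p) (- x) = F (- x) * (poly p (- x) - poly p x)"
    by (simp add: poly_H)
  moreover have expand: "a * (a * (u - v) - b * (v - u)) = (a + b) * (a * (u - v))"
    for a b u v :: real
    by algebra
  ultimately have "poly (H (H p)) x = (F x + F (- x)) * (F x * (poly p x - poly p (- x)))"
    using x by (simp only: poly_H insert_iff empty_iff de_Morgan_disj simp_thms expand)
  also have "\<dots> = - (\<rho>1 + \<rho>2) * (F x * (poly p x - poly p (- x)))"
    using x by (subst F_reflect) simp_all
  finally show "poly (H (H p)) x = poly (- smult (\<rho>1 + \<rho>2) (H p)) x"
    using x by (simp only: poly_H poly_minus poly_smult mult_minus_left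
        insert_iff empty_iff de_Morgan_disj simp_thms)
qed simp

lemma K_X: "K (X * p) = - (X * K p) - K p - [:1/2 - r1, 1:] * [:1/2 - r2, 1:] * p"
proof (rule poly_eqI_off_finite[of "{0, - 1/2}"])
  fix x :: real
  assume x: "x \<notin> {0, - 1/2}"
  then have "poly (K (X * p)) x + x * poly (K p) x + poly (K p) x = - ((2 * x + 1) * G x) * poly p x"
    by (simp add: poly_K algebra_simps)
  also have "\<dots> = - (poly ([:1/2 - r1, 1:] * [:1/2 - r2, 1:] * p) x)"
    using x by (subst G_times) (simp_all add: algebra_simps)
  finally show "poly (K (X * p)) x =
      poly (- (X * K p) - K p - [:1/2 - r1, 1:] * [:1/2 - r2, 1:] * p) x"
    by simp
qed simp

text \<open>Since \<open>L = H + K\<close>, the difference of \<open>L K + K L\<close> and \<open>L\<^sup>2\<close> is \<open>K\<^sup>2 - H\<^sup>2\<close>, which the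
  quadratic relations make linear in \<open>H\<close> and \<open>K\<close>.\<close>

lemma L_K_anticommutator:
  "L (K p) + K (L p) = L (L p) + smult (\<rho>1 + \<rho>2) (L p) - smult g (K p)"
proof -
  have "H (H p) = L (L p) - L (K p) - K (L p) + K (K p)"
    by (simp add: H_def L_diff K_diff)
  then have "L (K p) + K (L p) = L (L p) + smult (r1 + r2) (K p) + smult (\<rho>1 + \<rho>2) (H p)"
    unfolding K_K H_H by (simp add: algebra_simps)
  then show ?thesis
    by (simp add: H_def dunkl_g_def smult_diff_right smult_diff_left smult_add_left)
qed

definition M :: "real poly \<Rightarrow> real poly" where
  "M p = X * p + K p"

lemma M_add: "M (p + q) = M p + M q"
  by (simp add: M_def K_add algebra_simps)

lemma M_smult: "M (smult c p) = smult c (M p)"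
  by (simp add: M_def K_smult smult_add_right)

lemma M_M: "M (M p) = smult (r1 + r2 - 1) (M p) - smult ((r1 - 1/2) * (r2 - 1/2)) p"
proof -
  have "M (M p) = X * (X * p) + X * K p + (K (X * p) + K (K p))"
    by (simp only: M_def K_add distrib_left add.assoc)
  also have "\<dots> = smult (r1 + r2 - 1) (M p) - smult ((r1 - 1/2) * (r2 - 1/2)) p"
    unfolding K_X K_K
    by (intro poly_eq_poly_eq_iff[THEN iffD1] ext) (simp add: M_def field_simps)
  finally show ?thesis .
qed

lemma L_M_anticommutator:
  "L (M p) + M (L p) =
     L (L p) + smult (\<rho>1 + \<rho>2) (L p) + smult \<beta> p - smult (g + 1) (M p)"
proof -
  have "L (M p) + M (L p) = (L (X * p) + X * L p) + (L (K p) + K (L p))"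
    by (simp add: M_def L_add)
  also have "L (X * p) + X * L p = [:\<beta>, - (g + 1):] * p - K p"
    by (simp add: K_def)
  also have "\<dots> + (L (K p) + K (L p)) =
      L (L p) + smult (\<rho>1 + \<rho>2) (L p) + smult \<beta> p - smult (g + 1) (M p)"
    unfolding L_K_anticommutator
    by (intro poly_eq_poly_eq_iff[THEN iffD1] ext) (simp add: M_def algebra_simps)
  finally show ?thesis .
qed

section \<open>The raising chain\<close>

text \<open>The constants are forced by the requirement that \<open>Q (Suc n)\<close> be an eigenvector of \<open>L\<close>
  (\<open>raising_constant_even\<close> and \<open>raising_constant_odd\<close>). In each case this is a linear equation for the constant, whose
  coefficient is, up to sign, \<open>\<lambda>\<^sub>n\<^sub>+\<^sub>1 - \<lambda>\<^sub>n\<close>; hence the denominators \<open>n + 1 + g\<close>.\<close>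

primrec Q :: "nat \<Rightarrow> real poly" where
  "Q 0 = 1"
| "Q (Suc n) = (if even n then M (Q n) + smult (A n - \<rho>1 - ev n) (Q n)
                else smult (A n + ev n) (Q n) - K (Q n))"

lemma ev_Suc_even: "even n \<Longrightarrow> ev (Suc n) = - g - 1 - ev n"
  by (simp add: dunkl_eigenvalue_def dunkl_g_def field_simps)

lemma ev_Suc_odd: "odd n \<Longrightarrow> ev (Suc n) = - g - ev n"
  by (simp add: dunkl_eigenvalue_def dunkl_g_def field_simps)

end

locale dunkl_generic = dunkl_parameters +
  assumes generic: "\<And>n::nat. real n + 1 + g \<noteq> 0"
begin

text \<open>Eigenvalues of indices \<open>i\<close> even and \<open>j\<close> odd differ by \<open>(i + j + 1) / 2 + g\<close>, which is where
  the excluded values of \<open>g\<close> come from.\<close>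

lemma ev_inj:
  assumes "ev m = ev n"
  shows "m = n"
proof (rule ccontr)
  assume "m \<noteq> n"
  have parity: False if even: "even i" and odd: "odd j" and eq: "ev i = ev j" for i j
  proof -
    from odd obtain k where k: "j = 2 * k + 1" by (auto elim: oddE)
    from even obtain l where l: "i = 2 * l" by (auto elim: evenE)
    have "real (k + l) + 1 + g = 0"
      using eq by (simp add: k l dunkl_eigenvalue_def dunkl_g_def field_simps)
    then show False
      using generic by blast
  qed
  have "even m = even n"
    using parity[of m n] parity[of n m] assms by auto
  then show False
    using assms \<open>m \<noteq> n\<close> by (auto simp: dunkl_eigenvalue_def split: if_splits)
qed

text \<open>\<open>A n\<close> and \<open>C (Suc n)\<close> have the same denominator; cleared of it, the identities needed below
  are polynomial.\<close>

lemma A_even_times: "even n \<Longrightarrow> A n * (4 * (real n + 1 + g)) =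
      (real n + 1 + 2 * \<rho>1 - 2 * r1) * (real n + 1 + 2 * \<rho>1 - 2 * r2)"
    and A_odd_times: "odd n \<Longrightarrow> A n * (4 * (real n + 1 + g)) =
      (real n + 1 + 2 * g) * (real n + 1 + 2 * \<rho>1 + 2 * \<rho>2)"
    and C_Suc_even_times: "even n \<Longrightarrow> C (Suc n) * (4 * (real n + 1 + g)) =
      - ((real n + 1 - 2 * r2 + 2 * \<rho>2) * (real n + 1 - 2 * r1 + 2 * \<rho>2))"
    and C_Suc_odd_times: "odd n \<Longrightarrow> C (Suc n) * (4 * (real n + 1 + g)) =
      - ((real n + 1) * (real n + 1 - 2 * r1 - 2 * r2))"
proof -
  have nz: "4 * (real n + 1 + g) \<noteq> 0"
    using generic[of n] by simp
  have Suc: "real (Suc n) = real n + 1"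
    by simp
  note cancel = nonzero_eq_divide_eq[OF nz, THEN iffD1]
  show "A n * (4 * (real n + 1 + g)) =
      (real n + 1 + 2 * \<rho>1 - 2 * r1) * (real n + 1 + 2 * \<rho>1 - 2 * r2)" if "even n"
    using that by (intro cancel) (simp add: dunkl_A_def Let_def)
  show "A n * (4 * (real n + 1 + g)) =
      (real n + 1 + 2 * g) * (real n + 1 + 2 * \<rho>1 + 2 * \<rho>2)" if "odd n"
    using that by (intro cancel) (simp add: dunkl_A_def Let_def)
  show "C (Suc n) * (4 * (real n + 1 + g)) =
      - ((real n + 1 - 2 * r2 + 2 * \<rho>2) * (real n + 1 - 2 * r1 + 2 * \<rho>2))" if "even n"
    using that by (intro cancel) (simp add: dunkl_C_def Let_def Suc del: of_nat_Suc)
  show "C (Suc n) * (4 * (real n + 1 + g)) =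
      - ((real n + 1) * (real n + 1 - 2 * r1 - 2 * r2))" if "odd n"
    using that by (intro cancel) (simp add: dunkl_C_def Let_def Suc del: of_nat_Suc)
qed

lemma A_add_C_even:
  assumes "even n"
  shows "A n + C (Suc n) = \<rho>1 - \<rho>2"
proof -
  have "(A n + C (Suc n)) * (4 * (real n + 1 + g)) = (\<rho>1 - \<rho>2) * (4 * (real n + 1 + g))"
    using A_even_times[OF assms] C_Suc_even_times[OF assms] unfolding dunkl_g_def by algebra
  then show ?thesis
    using generic[of n] by simp
qed

lemma A_add_C_odd:
  assumes "odd n"
  shows "A n + C (Suc n) = \<rho>1 + \<rho>2"
proof -
  have "(A n + C (Suc n)) * (4 * (real n + 1 + g)) = (\<rho>1 + \<rho>2) * (4 * (real n + 1 + g))"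
    using A_odd_times[OF assms] C_Suc_odd_times[OF assms] unfolding dunkl_g_def by algebra
  then show ?thesis
    using generic[of n] by simp
qed

lemma raising_constant_even:
  assumes "even n"
  shows "(A n - \<rho>1 - ev n) * (ev (Suc n) - ev n) = ev n * ev n + (\<rho>1 + \<rho>2) * ev n + \<beta>"
proof -
  have n: "real n = 2 * ev n"
    using assms by (simp add: dunkl_eigenvalue_def)
  have "4 * ((A n - \<rho>1 - ev n) * (ev (Suc n) - ev n)) =
      4 * (ev n * ev n + (\<rho>1 + \<rho>2) * ev n) + (4 * \<rho>1 * \<rho>2 - (2 * r1 - 1) * (2 * r2 - 1))"
    using A_even_times[OF assms] unfolding ev_Suc_even[OF assms] n dunkl_g_def by algebra
  then show ?thesis
    by (simp add: algebra_simps)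
qed

lemma raising_constant_odd:
  assumes "odd n"
  shows "(A n + ev n) * (ev n - ev (Suc n)) = ev n * (ev n + \<rho>1 + \<rho>2)"
proof -
  have n: "real n = - 2 * ev n - 2 * g - 1"
    using assms by (simp add: dunkl_eigenvalue_def dunkl_g_def field_simps)
  have "4 * ((A n + ev n) * (ev n - ev (Suc n))) = 4 * (ev n * (ev n + \<rho>1 + \<rho>2))"
    using A_odd_times[OF assms] unfolding ev_Suc_odd[OF assms] n dunkl_g_def by algebra
  then show ?thesis
    by simp
qed

lemma L_Q: "L (Q n) = smult (ev n) (Q n)"
proof (induction n)
  case 0
  show ?case by (simp add: L_1 dunkl_eigenvalue_def)
next
  case (Suc n)
  show ?case
  proof (cases "even n")
    case True
    define c where "c = A n - \<rho>1 - ev n"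
    have Q: "Q (Suc n) = M (Q n) + smult c (Q n)"
      using True by (simp add: c_def)
    have "L (M (Q n)) = smult (ev n * ev n + (\<rho>1 + \<rho>2) * ev n + \<beta>) (Q n)
        + smult (ev (Suc n)) (M (Q n))"
      using L_M_anticommutator[of "Q n"] True
      by (simp add: Suc.IH L_smult M_smult ev_Suc_even algebra_simps
          smult_add_left smult_diff_left)
    also have "ev n * ev n + (\<rho>1 + \<rho>2) * ev n + \<beta> = c * (ev (Suc n) - ev n)"
      using raising_constant_even[OF True] by (simp add: c_def)
    finally show ?thesis
      unfolding Q L_add L_smult Suc.IH
      by (simp add: algebra_simps smult_add_right smult_diff_left)
  next
    case False
    define a where "a = A n + ev n"
    have Q: "Q (Suc n) = smult a (Q n) - K (Q n)"
      using False by (simp add: a_def)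
    have "L (K (Q n)) = smult (ev n * (ev n + \<rho>1 + \<rho>2)) (Q n) + smult (ev (Suc n)) (K (Q n))"
      using L_K_anticommutator[of "Q n"] False
      by (simp add: Suc.IH L_smult K_smult ev_Suc_odd algebra_simps
          smult_add_left smult_diff_left)
    also have "ev n * (ev n + \<rho>1 + \<rho>2) = a * (ev n - ev (Suc n))"
      using raising_constant_odd[of n] False by (simp add: a_def)
    finally show ?thesis
      unfolding Q L_diff L_smult Suc.IH
      by (simp add: algebra_simps smult_diff_right smult_diff_left)
  qed
qed

lemma Q_1: "Q (Suc 0) + smult (\<rho>1 - A 0) (Q 0) = X * Q 0"
  by (simp add: M_def K_1 dunkl_eigenvalue_def)

section \<open>The three-term recurrence\<close>

text \<open>The quadratic \<open>(c + r1 - 1/2) (c + r2 - 1/2)\<close> is the characteristic polynomial of \<open>M\<close> at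
  \<open>- c\<close> (see \<open>M_M\<close>), where \<open>c\<close> is the raising constant; likewise \<open>a (a - r1 - r2)\<close> in
  \<open>off_diagonal_odd\<close> is that of \<open>K\<close> at \<open>a\<close>. Their values are the off-diagonal recurrence
  coefficients, up to sign.\<close>

lemma off_diagonal_even:
  assumes "even n"
  shows "(A n - \<rho>1 - ev n + r1 - 1/2) * (A n - \<rho>1 - ev n + r2 - 1/2) = - (A n * C (Suc n))"
proof -
  have n: "real n = 2 * ev n"
    using assms by (simp add: dunkl_eigenvalue_def)
  have C: "C (Suc n) = \<rho>1 - \<rho>2 - A n"
    using A_add_C_even[OF assms] by simp
  have "(2 * (A n - \<rho>1 - ev n) + 2 * r1 - 1) * (2 * (A n - \<rho>1 - ev n) + 2 * r2 - 1) =
      - (4 * (A n * C (Suc n)))"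
    using A_even_times[OF assms] unfolding C n dunkl_g_def by algebra
  then show ?thesis
    by (simp add: algebra_simps)
qed

lemma off_diagonal_odd:
  assumes "odd n"
  shows "(A n + ev n) * (A n + ev n - r1 - r2) = - (A n * C (Suc n))"
proof -
  have C: "C (Suc n) = \<rho>1 + \<rho>2 - A n" using A_add_C_odd[OF assms] by simp
  have "(A n + ev n) * (2 * ev n + g) = ev n * (ev n + \<rho>1 + \<rho>2)"
    using raising_constant_odd[OF assms] assms by (simp add: ev_Suc_odd)
  then show ?thesis unfolding C dunkl_g_def by (simp add: algebra_simps)
qed

lemma Q_rec:
  "Q (Suc (Suc n)) + smult (\<rho>1 - A (Suc n) - C (Suc n)) (Q (Suc n))
     + smult (A n * C (Suc n)) (Q n) = X * Q (Suc n)"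
proof (cases "even n")
  case True
  let ?c = "A n - \<rho>1 - ev n" and ?q = "(r1 - 1/2) * (r2 - 1/2)"
  have M_Q: "M (Q n) = Q (Suc n) - smult ?c (Q n)"
    using True by simp
  have "M (Q (Suc n)) = smult (r1 + r2 - 1 + ?c) (M (Q n)) - smult ?q (Q n)"
    using True by (simp add: M_add M_smult M_M smult_add_left)
  also have "\<dots> = smult (r1 + r2 - 1 + ?c) (Q (Suc n))
      - smult ((?c + r1 - 1/2) * (?c + r2 - 1/2)) (Q n)"
    unfolding M_Q
    by (intro poly_eq_poly_eq_iff[THEN iffD1] ext) (simp add: field_simps del: Q.simps)
  also have "\<dots> = smult (r1 + r2 - 1 + ?c) (Q (Suc n)) + smult (A n * C (Suc n)) (Q n)"
    by (simp add: off_diagonal_even[OF True] del: Q.simps)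
  finally have 1: "M (Q (Suc n)) = \<dots>" .
  have 2: "Q (Suc (Suc n)) = smult (A (Suc n) + ev (Suc n)) (Q (Suc n)) - (M (Q (Suc n)) - X * Q (Suc n))"
    using True by (simp add: M_def)
  have 3: "C (Suc n) = \<rho>1 - \<rho>2 - A n" using A_add_C_even[OF True] by simp
  show ?thesis
    unfolding 2 1 using True
    by (intro poly_eq_poly_eq_iff[THEN iffD1] ext)
      (simp add: 3 ev_Suc_even dunkl_g_def algebra_simps del: Q.simps)
next
  case False
  let ?a = "A n + ev n"
  have K_Q: "K (Q n) = smult ?a (Q n) - Q (Suc n)"
    using False by simp
  have "K (Q (Suc n)) = smult (?a - r1 - r2) (K (Q n))"
    using False by (simp add: K_add K_diff K_smult K_K smult_diff_left smult_add_left)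
  also have "\<dots> = smult (?a * (?a - r1 - r2)) (Q n) - smult (?a - r1 - r2) (Q (Suc n))"
    unfolding K_Q by (simp add: smult_diff_right mult.commute del: Q.simps)
  also have "\<dots> = - smult (A n * C (Suc n)) (Q n) - smult (?a - r1 - r2) (Q (Suc n))"
    using False by (simp add: off_diagonal_odd del: Q.simps)
  finally have 1: "K (Q (Suc n)) = \<dots>" .
  have 2: "Q (Suc (Suc n)) = X * Q (Suc n) + K (Q (Suc n))
      + smult (A (Suc n) - \<rho>1 - ev (Suc n)) (Q (Suc n))"
    using False by (simp add: M_def)
  have 3: "C (Suc n) = \<rho>1 + \<rho>2 - A n" using A_add_C_odd[of n] False by simp
  show ?thesis
    unfolding 2 1 using False
    by (intro poly_eq_poly_eq_iff[THEN iffD1] ext)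
      (simp add: 3 ev_Suc_odd dunkl_g_def algebra_simps del: Q.simps)
qed

lemma Q_monic: "degree (Q n) = n \<and> lead_coeff (Q n) = 1"
proof (induction n rule: less_induct)
  case (less n)
  have step: "degree q = Suc m \<and> lead_coeff q = 1"
    if p: "degree p = m" "lead_coeff p = 1" and q: "q + r = X * p" "degree r \<le> m"
    for p q r :: "real poly" and m
  proof -
    have "p \<noteq> 0"
      using p by auto
    then have d: "degree (X * p) = Suc m"
      using p by simp
    have "degree r < degree (X * p)"
      using d q by simp
    moreover have q': "q = - r + X * p"
      using q by (simp add: algebra_simps)
    ultimately have "degree q = Suc m"
      using d degree_add_eq_right[of "- r" "X * p"] by simp
    moreover have "coeff q (Suc m) = 1"
      using p q unfolding q' by (simp add: coeff_eq_0)
    ultimately show ?thesis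
      by simp
  qed
  consider "n = 0" | "n = Suc 0" | m where "n = Suc (Suc m)"
    by (metis not0_implies_Suc)
  then show ?case
  proof cases
    case 1
    then show ?thesis by simp
  next
    case 2
    show ?thesis
      unfolding 2 by (rule step[OF _ _ Q_1]) simp_all
  next
    case (3 m)
    have "degree (Q m) = m" "degree (Q (Suc m)) = Suc m" "lead_coeff (Q (Suc m)) = 1"
      using less.IH[of m] less.IH[of "Suc m"] 3 by (auto simp del: Q.simps)
    then show ?thesis
      unfolding 3 using Q_rec[of m] unfolding add.assoc
      by (intro step) (auto simp del: Q.simps intro!: degree_add_le degree_smult_le[THEN order_trans])
  qed
qed

section \<open>Uniqueness and the Bannai-Ito polynomials\<close>

text \<open>The degree bound is not read off from the formula for \<open>L\<close>: it is inherited from the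
  monic eigenvectors \<open>Q n\<close>, by subtracting from \<open>p\<close> its leading coefficient times \<open>Q n\<close>.\<close>

lemma L_triangular:
  "degree p \<le> n \<Longrightarrow> degree (L p) \<le> n \<and> coeff (L p) n = ev n * coeff p n"
proof (induction n arbitrary: p)
  case 0
  then obtain c where p: "p = smult c 1"
    using degree_eq_zeroE[of p]
    by (metis le_zero_eq one_pCons smult_pCons smult_0_right mult.right_neutral)
  have "L p = 0"
    unfolding p L_smult L_1 by simp
  then show ?case
    by (simp add: dunkl_eigenvalue_def)
next
  case (Suc n)
  define c where "c = coeff p (Suc n)"
  define e where "e = p - smult c (Q (Suc n))"
  have Q: "degree (Q (Suc n)) = Suc n" "coeff (Q (Suc n)) (Suc n) = 1"
    using Q_monic[of "Suc n"] by (auto simp del: Q.simps)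
  have "degree e \<le> n"
  proof (rule degree_le, intro allI impI)
    fix i assume "n < i"
    show "coeff e i = 0"
    proof (cases "i = Suc n")
      case True
      then show ?thesis using Q by (simp add: e_def c_def del: Q.simps)
    next
      case False
      then have "Suc n < i" using \<open>n < i\<close> by simp
      then show ?thesis using Q Suc.prems by (simp add: e_def coeff_eq_0 del: Q.simps)
    qed
  qed
  then have e: "degree (L e) \<le> n"
    using Suc.IH by blast
  have "p = smult c (Q (Suc n)) + e"
    by (simp add: e_def)
  then have Lp: "L p = smult (c * ev (Suc n)) (Q (Suc n)) + L e"
    by (metis L_add L_smult L_Q smult_smult)
  have "degree (L p) \<le> Suc n"
    unfolding Lp using e Q
    by (intro degree_add_le degree_smult_le[THEN order_trans]) simp_all
  moreover have "coeff (L p) (Suc n) = ev (Suc n) * c"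
    unfolding Lp using e Q by (simp add: coeff_eq_0 del: Q.simps)
  ultimately show ?case
    by (simp add: c_def)
qed

lemma eigenvalue_of_degree:
  assumes "L p = smult \<mu> p" "p \<noteq> 0"
  shows "\<mu> = ev (degree p)"
  using L_triangular[of p "degree p"] assms by simp

lemma dunkl_eigenpoly_eq_Q: "dunkl_eigenpoly r1 r2 \<rho>1 \<rho>2 n = Q n"
  unfolding dunkl_eigenpoly_def
proof (rule the_equality)
  show "degree (Q n) = n \<and> lead_coeff (Q n) = 1 \<and> L (Q n) = smult (ev n) (Q n)"
    using Q_monic L_Q by blast
next
  fix p
  assume p: "degree p = n \<and> lead_coeff p = 1 \<and> L p = smult (ev n) p"
  show "p = Q n"
  proof (rule ccontr)
    assume "p \<noteq> Q n"
    then have nz: "p - Q n \<noteq> 0"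
      by simp
    have "L (p - Q n) = smult (ev n) (p - Q n)"
      using p by (simp add: L_diff L_Q smult_diff_right)
    then have "degree (p - Q n) = n"
      using eigenvalue_of_degree[OF _ nz] ev_inj by metis
    moreover have "coeff (p - Q n) n = 0"
      using p Q_monic[of n] by (metis coeff_diff diff_self)
    ultimately show False
      using nz leading_coeff_0_iff by metis
  qed
qed

lemma BI_A_eq:
  "BI_A (1/4) (2 * (\<rho>1 - r1)) (2 * (\<rho>1 - r2)) (- 2 * (\<rho>1 + \<rho>2)) (2 * (r1 + r2 - \<rho>1 - \<rho>2)) n = A n"
proof -
  have "2 * real n + 2 - 2 * (r1 + r2 - \<rho>1 - \<rho>2) = 2 * (real n + 1 + g)"
    by (simp add: dunkl_g_def)
  then show ?thesis
    by (simp add: BI_A_def dunkl_A_def Let_def) (simp add: dunkl_g_def algebra_simps)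
qed

lemma BI_C_eq:
  "BI_C (1/4) (2 * (\<rho>1 - r1)) (2 * (\<rho>1 - r2)) (- 2 * (\<rho>1 + \<rho>2)) (2 * (r1 + r2 - \<rho>1 - \<rho>2)) n = C n"
proof -
  have "2 * real n - 2 * (r1 + r2 - \<rho>1 - \<rho>2) = 2 * (real n + g)"
    by (simp add: dunkl_g_def)
  then show ?thesis
    by (simp add: BI_C_def dunkl_C_def Let_def) (simp add: dunkl_g_def algebra_simps)
qed

lemma bannai_ito_eq_Q:
  "bannai_ito \<rho>1 (1/4) (2 * (\<rho>1 - r1)) (2 * (\<rho>1 - r2)) (- 2 * (\<rho>1 + \<rho>2))
     (2 * (r1 + r2 - \<rho>1 - \<rho>2)) n = Q n"
proof (induction n rule: induct_nat_012)
  case 0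
  show ?case by simp
next
  case 1
  have "C 0 = 0"
    by (simp add: dunkl_C_def)
  then have "bannai_ito \<rho>1 (1/4) (2 * (\<rho>1 - r1)) (2 * (\<rho>1 - r2)) (- 2 * (\<rho>1 + \<rho>2))
      (2 * (r1 + r2 - \<rho>1 - \<rho>2)) (Suc 0) = X * Q 0 - smult (\<rho>1 - A 0) (Q 0)"
    unfolding bannai_ito.simps BI_b_def BI_A_eq BI_C_eq by simp
  then show ?case
    unfolding Q_1[symmetric] by simp
next
  case (ge2 n)
  show ?case
    unfolding bannai_ito.simps ge2 BI_b_def BI_u_def BI_A_eq BI_C_eq
    using Q_rec[of n]
    by (simp add: algebra_simps smult_diff_left smult_add_left del: Q.simps)
qed

end

theorem mainTheorem2:
  fixes r1 r2 \<rho>1 \<rho>2 :: real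
  assumes "\<forall>k::nat. k \<ge> 1 \<longrightarrow> r1 + r2 - \<rho>1 - \<rho>2 \<noteq> real k"
  shows "(\<forall>n. dunkl_eigenpoly r1 r2 \<rho>1 \<rho>2 (n + 1)
            + smult (\<rho>1 - dunkl_A r1 r2 \<rho>1 \<rho>2 n - dunkl_C r1 r2 \<rho>1 \<rho>2 n)
                (dunkl_eigenpoly r1 r2 \<rho>1 \<rho>2 n)
            + (if n = 0 then 0
               else smult (dunkl_A r1 r2 \<rho>1 \<rho>2 (n - 1) * dunkl_C r1 r2 \<rho>1 \<rho>2 n)
                      (dunkl_eigenpoly r1 r2 \<rho>1 \<rho>2 (n - 1)))
            = [:0, 1:] * dunkl_eigenpoly r1 r2 \<rho>1 \<rho>2 n)
       \<and> (\<forall>n. dunkl_eigenpoly r1 r2 \<rho>1 \<rho>2 n =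
            bannai_ito \<rho>1 (1/4) (2 * (\<rho>1 - r1)) (2 * (\<rho>1 - r2)) (- 2 * (\<rho>1 + \<rho>2))
              (2 * (r1 + r2 - \<rho>1 - \<rho>2)) n)"
proof -
  interpret dunkl_generic r1 r2 \<rho>1 \<rho>2
  proof
    fix n :: nat
    show "real n + 1 + dunkl_g r1 r2 \<rho>1 \<rho>2 \<noteq> 0"
      using assms[rule_format, of "Suc n"] by (simp add: dunkl_g_def)
  qed
  have "Q (n + 1) + smult (\<rho>1 - A n - C n) (Q n)
      + (if n = 0 then 0 else smult (A (n - 1) * C n) (Q (n - 1))) = X * Q n" for n
  proof (cases n)
    case 0
    have "C 0 = 0"
      by (simp add: dunkl_C_def)
    with Q_1 show ?thesis
      by (simp add: 0 del: Q.simps(2))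
  next
    case (Suc m)
    with Q_rec[of m] show ?thesis
      by (simp del: Q.simps)
  qed
  then show ?thesis
    unfolding dunkl_eigenpoly_eq_Q bannai_ito_eq_Q by blast
qed

end
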